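(* Let $m$ be a positive integer and let $r,s,u$ be real numbers with $$1\leq s\leq u<\frac{mrs}{mr-s}.$$ Then, for any Banach spaces $E_{1},\dots,E_{m},F$ over $\mathbb{K}$, $$\Pi_{(r;s)}^{m}(E_{1},\dots,E_{m};F)\subset\Pi_{\left(\frac{rsu}{su+mrs-mru};u\right)}^{m}(E_{1},\dots,E_{m};F),$$ and the inclusion has norm $1$.
   Context: $\mathbb{K}$ is $\mathbb{R}$ or $\mathbb{C}$. The convention $\frac{1}{0}=\infty$ is used. For a Banach space $E$ with closed unit ball $B_{E^*}$ of its dual and $p\in[1,\infty)$, $\ell_p^w(E)$ is the space of sequences $(x_j)_{j\ge1}$ in $E$ with $\|(x_j)\|_{w,p}:=\sup_{\varphi\in B_{E^*}}\left(\sum_{j}|\varphi(x_j)|^p\right)^{1/p}<\infty$. For $q,p\in[1,\infty)$ (the classes below are defined only for exponents at least $1$), $\Pi^m_{(q;p)}(E_1,\dots,E_m;F)$ denotes the class of multiple $(q;p)$-summing operators: bounded $m$-linear operators $T\colon E_1\times\cdots\times E_m\to F$ for which there is a constant $C>0$ such that $$\left(\sum_{j_1,\dots,j_m=1}^\infty\left\|T(x^{(1)}_{j_1},\dots,x^{(m)}_{j_m})\right\|^q\right)^{1/q}\le C\prod_{k=1}^m\left\|(x^{(k)}_{j})_{j=1}^\infty\right\|_{w,p}$$ for all $(x^{(k)}_j)_{j}\in\ell_p^w(E_k)$, $k=1,\dots,m$. The infimum of such $C$ is the norm $\pi_{(q;p)}(T)$. The norm of the inclusion is its operator norm with respect to these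 norms.
   Formalization: The inclusion always has norm at most 1; norm exactly 1 is stated only when the source class contains a nonzero operator, since otherwise (e.g. some E_k = {0}, or r < s) the class is {0} and the inclusion has norm 0. *)

theory Defs
  imports "HOL-Analysis.Analysis" "HOL-Algebra.Module"
begin

section \<open>Banach spaces over the reals or the complex numbers\<close>

text \<open>
  The scalar field is a set \<^term>\<open>K :: complex set\<close>, to be taken as \<^term>\<open>\<real>\<close> or \<^term>\<open>UNIV\<close>.
  A Banach space is a record with its own carrier, operations and norm. A family of Banach
  spaces \<open>E 1, \<dots>, E m\<close> thus shares only the type \<open>'a\<close> of the elements, which
  is arbitrary, so that the spaces may be completely unrelated.
\<close>

definition scalars :: "complex set \<Rightarrow> complex ring"
  where "scalars K = \<lparr>carrier = K, monoid.mult = (*), one = 1, ring.zero = 0, add = (+)\<rparr>"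

record 'a normed_space = "(complex, 'a) module" +
  vnorm :: "'a \<Rightarrow> real"  (\<open>\<parallel>_\<parallel>\<index>\<close> [0] 1000)

text \<open>
  The locale \<^locale>\<open>Metric_space\<close> wants a nonnegative symmetric function on the whole
  type, hence the value 0 outside of the carrier.
\<close>

definition vdist :: "'a normed_space \<Rightarrow> 'a \<Rightarrow> 'a \<Rightarrow> real"
  where "vdist E x y =
    (if x \<in> carrier E \<and> y \<in> carrier E then \<parallel>x \<ominus>\<^bsub>E\<^esub> y\<parallel>\<^bsub>E\<^esub> else 0)"

locale banach_space = Module.module "scalars K" E
  for K :: "complex set" and E :: "'a normed_space" (structure) +
  assumes vnorm_nonneg: "x \<in> carrier E \<Longrightarrow> 0 \<le> \<parallel>x\<parallel>"
    and vnorm_eq_0: "x \<in> carrier E \<Longrightarrow> \<parallel>x\<parallel> = 0 \<longleftrightarrow> x = \<zero>"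
    and vnorm_smult: "c \<in> K \<Longrightarrow> x \<in> carrier E \<Longrightarrow> \<parallel>c \<odot> x\<parallel> = cmod c * \<parallel>x\<parallel>"
    and vnorm_triangle: "x \<in> carrier E \<Longrightarrow> y \<in> carrier E \<Longrightarrow> \<parallel>x \<oplus> y\<parallel> \<le> \<parallel>x\<parallel> + \<parallel>y\<parallel>"
    and complete: "Metric_space.mcomplete (carrier E) (vdist E)"


section \<open>Weakly summable sequences\<close>

definition dual_ball :: "complex set \<Rightarrow> 'a normed_space \<Rightarrow> ('a \<Rightarrow> complex) set"
  where "dual_ball K E = {\<phi> \<in> carrier E \<rightarrow> K.
    (\<forall>x\<in>carrier E. \<forall>y\<in>carrier E. \<phi> (x \<oplus>\<^bsub>E\<^esub> y) = \<phi> x + \<phi> y) \<and>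
    (\<forall>c\<in>K. \<forall>x\<in>carrier E. \<phi> (c \<odot>\<^bsub>E\<^esub> x) = c * \<phi> x) \<and>
    (\<forall>x\<in>carrier E. cmod (\<phi> x) \<le> \<parallel>x\<parallel>\<^bsub>E\<^esub>)}"

text \<open>
  The two conditions together express that the supremum which defines the weak norm is finite;
  the value of \<open>weak_norm\<close> is meaningful on \<open>weak_lp\<close> only.
\<close>

definition weak_lp :: "complex set \<Rightarrow> real \<Rightarrow> 'a normed_space \<Rightarrow> (nat \<Rightarrow> 'a) set"
  where "weak_lp K p E = {x \<in> UNIV \<rightarrow> carrier E.
    (\<forall>\<phi>\<in>dual_ball K E. summable (\<lambda>j. cmod (\<phi> (x j)) powr p)) \<and>
    bdd_above ((\<lambda>\<phi>. (\<Sum>j. cmod (\<phi> (x j)) powr p) powr (1 / p)) ` dual_ball K E)}"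

definition weak_norm :: "complex set \<Rightarrow> real \<Rightarrow> 'a normed_space \<Rightarrow> (nat \<Rightarrow> 'a) \<Rightarrow> real"
  where "weak_norm K p E x = (SUP \<phi>\<in>dual_ball K E. (\<Sum>j. cmod (\<phi> (x j)) powr p) powr (1 / p))"


section \<open>Multiple summing operators\<close>

definition tuples :: "nat \<Rightarrow> (nat \<Rightarrow> 'a normed_space) \<Rightarrow> (nat \<Rightarrow> 'a) set"
  where "tuples m E = (\<Pi>\<^sub>E k\<in>{1..m}. carrier (E k))"

text \<open>
  Operators are extensional functions on \<^term>\<open>tuples m E\<close>, so that equality of functions is
  equality of operators.
\<close>

definition bounded_multilinear ::
    "complex set \<Rightarrow> nat \<Rightarrow> (nat \<Rightarrow> 'a normed_space) \<Rightarrow> 'b normed_space \<Rightarrow> ((nat \<Rightarrow> 'a) \<Rightarrow> 'b) set"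
  where "bounded_multilinear K m E F = {T \<in> tuples m E \<rightarrow>\<^sub>E carrier F.
    (\<forall>x\<in>tuples m E. \<forall>k\<in>{1..m}. \<forall>a\<in>carrier (E k). \<forall>b\<in>carrier (E k).
        T (x(k := a \<oplus>\<^bsub>E k\<^esub> b)) = T (x(k := a)) \<oplus>\<^bsub>F\<^esub> T (x(k := b))) \<and>
    (\<forall>x\<in>tuples m E. \<forall>k\<in>{1..m}. \<forall>c\<in>K. \<forall>a\<in>carrier (E k).
        T (x(k := c \<odot>\<^bsub>E k\<^esub> a)) = c \<odot>\<^bsub>F\<^esub> T (x(k := a))) \<and>
    (\<exists>B. \<forall>x\<in>tuples m E. \<parallel>T x\<parallel>\<^bsub>F\<^esub> \<le> B * (\<Prod>k=1..m. \<parallel>x k\<parallel>\<^bsub>E k\<^esub>))}"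

text \<open>
  The sum over \<open>j\<^sub>1, \<dots>, j\<^sub>m\<close> is a sum over the functions \<^term>\<open>j\<close> from
  \<^term>\<open>{1..m}\<close> to \<^typ>\<open>nat\<close>; sequences are indexed from 0.
\<close>

definition summing_bound ::
    "complex set \<Rightarrow> nat \<Rightarrow> (nat \<Rightarrow> 'a normed_space) \<Rightarrow> 'b normed_space \<Rightarrow> real \<Rightarrow> real
      \<Rightarrow> ((nat \<Rightarrow> 'a) \<Rightarrow> 'b) \<Rightarrow> real \<Rightarrow> bool"
  where "summing_bound K m E F q p T C \<longleftrightarrow> C > 0 \<and>
    (\<forall>x. (\<forall>k\<in>{1..m}. x k \<in> weak_lp K p (E k)) \<longrightarrow>
      (\<lambda>j. \<parallel>T (\<lambda>k\<in>{1..m}. x k (j k))\<parallel>\<^bsub>F\<^esub> powr q) summable_on ({1..m} \<rightarrow>\<^sub>E UNIV) \<and>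
      (\<Sum>\<^sub>\<infinity>j\<in>{1..m} \<rightarrow>\<^sub>E UNIV. \<parallel>T (\<lambda>k\<in>{1..m}. x k (j k))\<parallel>\<^bsub>F\<^esub> powr q) powr (1 / q)
        \<le> C * (\<Prod>k=1..m. weak_norm K p (E k) (x k)))"

definition multiple_summing ::
    "complex set \<Rightarrow> nat \<Rightarrow> (nat \<Rightarrow> 'a normed_space) \<Rightarrow> 'b normed_space \<Rightarrow> real \<Rightarrow> real
      \<Rightarrow> ((nat \<Rightarrow> 'a) \<Rightarrow> 'b) set"
  where "multiple_summing K m E F q p =
    {T \<in> bounded_multilinear K m E F. \<exists>C. summing_bound K m E F q p T C}"

definition summing_norm ::
    "complex set \<Rightarrow> nat \<Rightarrow> (nat \<Rightarrow> 'a normed_space) \<Rightarrow> 'b normed_space \<Rightarrow> real \<Rightarrow> real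
      \<Rightarrow> ((nat \<Rightarrow> 'a) \<Rightarrow> 'b) \<Rightarrow> real"
  where "summing_norm K m E F q p T = Inf {C. summing_bound K m E F q p T C}"

text \<open>
  The operator norm of the inclusion of \<open>A\<close>, normed by \<open>n\<close>, into a space normed by \<open>n'\<close>.
  It is an extended real, so that an unbounded inclusion has norm \<open>\<infinity>\<close>.
\<close>

definition inclusion_norm :: "'t set \<Rightarrow> ('t \<Rightarrow> real) \<Rightarrow> ('t \<Rightarrow> real) \<Rightarrow> ereal"
  where "inclusion_norm A n n' = (SUP T\<in>{T \<in> A. n T \<le> 1}. ereal (n' T))"

end

(*
  Write 1/t = 1/s - 1/u. Multiplying a weakly u-summable sequence by a weight in l_t yields, by
  Hoelder, a weakly s-summable sequence, so the (r;s)-summing inequality gives a weighted estimate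
  for the numbers |T x_j|, valid for all weights in each of the m coordinates. The weights are then
  removed one coordinate at a time: testing with the weight that is extremal in Hoelder's inequality
  and using l_a in l_b with norm 1 replaces the outer exponent a by b, 1/b = 1/a - 1/t. After m steps
  the exponent is q, and no constant is lost.

  For the reverse inequality on the norm, a nonzero (r;s)-summing operator forces s <= r (test on
  scalar sequences) and, for each k, a nonzero functional on E_k: otherwise every weak norm on E_k
  vanishes, and so would T. No Hahn-Banach theorem is needed. The tensor product of
  norm 1 functionals with a unit vector of F then has both summing norms equal to 1.
*)
theory Submission
  imports Defs
begin

section \<open>Hoelder's inequality and the removal of weights from finite sums\<close>

section \<open>Inequalities for finite sums\<close>

text \<open>Hoelder's inequality for the exponents \<open>1 / \<alpha>\<close> and
  \<open>1 / \<beta>\<close>: once both families are normalised by their sums, Young's inequality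
  applies to each term.\<close>

lemma sum_powr_mult_powr_le:
  fixes x y :: "'i \<Rightarrow> real"
  assumes "\<And>i. i \<in> I \<Longrightarrow> 0 \<le> x i" "\<And>i. i \<in> I \<Longrightarrow> 0 \<le> y i"
    and ab: "0 < \<alpha>" "0 < \<beta>" "\<alpha> + \<beta> = 1"
  shows "(\<Sum>i\<in>I. x i powr \<alpha> * y i powr \<beta>) \<le> (\<Sum>i\<in>I. x i) powr \<alpha> * (\<Sum>i\<in>I. y i) powr \<beta>"
proof (cases "finite I \<and> (\<Sum>i\<in>I. x i) \<noteq> 0 \<and> (\<Sum>i\<in>I. y i) \<noteq> 0")
  case True
  define X Y where "X = (\<Sum>i\<in>I. x i)" and "Y = (\<Sum>i\<in>I. y i)"
  have XY: "0 < X" "0 < Y"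
    using True assms by (auto simp: X_def Y_def less_le sum_nonneg)
  have "x i powr \<alpha> * y i powr \<beta> \<le> X powr \<alpha> * Y powr \<beta> * (\<alpha> * (x i / X) + \<beta> * (y i / Y))" if "i \<in> I" for i
  proof (cases "x i = 0 \<or> y i = 0")
    case True
    then show ?thesis using assms XY that by auto
  next
    case False
    then have "0 < x i / X" "0 < y i / Y" using assms XY that by (auto simp: less_le)
    then have "(x i / X) powr \<alpha> * (y i / Y) powr \<beta> \<le> \<alpha> * (x i / X) + \<beta> * (y i / Y)"
      using ab by (intro Youngs_inequality_0) auto
    then show ?thesis
      using XY assms that by (simp add: powr_divide field_simps)
  qed
  then have "(\<Sum>i\<in>I. x i powr \<alpha> * y i powr \<beta>)
      \<le> (\<Sum>i\<in>I. X powr \<alpha> * Y powr \<beta> * (\<alpha> * (x i / X) + \<beta> * (y i / Y)))"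
    by (rule sum_mono)
  also have "\<dots> = X powr \<alpha> * Y powr \<beta> * (\<alpha> * (X / X) + \<beta> * (Y / Y))"
    by (simp add: X_def Y_def sum.distrib flip: sum_distrib_left sum_divide_distrib)
  also have "\<dots> = X powr \<alpha> * Y powr \<beta>"
    using XY ab by simp
  finally show ?thesis by (simp add: X_def Y_def)
next
  case False
  \<comment> \<open>A vanishing sum of nonnegative terms has only zero terms, and a sum over an
    infinite set is 0 by convention, so both sides are 0.\<close>
  then consider "infinite I" | "\<And>i. i \<in> I \<Longrightarrow> x i = 0" | "\<And>i. i \<in> I \<Longrightarrow> y i = 0"
    using assms by (auto simp: sum_nonneg_eq_0_iff)
  then show ?thesis by cases auto
qed

text \<open>This is the inclusion of l_1 in l_c with norm 1: of
  \<open>x i * x i powr (c - 1)\<close>, the second factor is bounded through \<open>x i\<close>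
  being at most the total sum.\<close>

lemma sum_powr_le_powr_sum:
  fixes x :: "'i \<Rightarrow> real"
  assumes "finite I" "\<And>i. i \<in> I \<Longrightarrow> 0 \<le> x i" "1 \<le> c"
  shows "(\<Sum>i\<in>I. x i powr c) \<le> (\<Sum>i\<in>I. x i) powr c"
proof -
  have split: "z powr c = z * z powr (c - 1)" if "0 \<le> z" for z :: real
    using that by (cases "z = 0") (simp_all add: powr_diff)
  have "(\<Sum>i\<in>I. x i powr c) \<le> (\<Sum>i\<in>I. x i * (\<Sum>i\<in>I. x i) powr (c - 1))"
  proof (rule sum_mono)
    fix i assume i: "i \<in> I"
    then have "x i \<le> (\<Sum>i\<in>I. x i)" using assms by (meson member_le_sum DiffD1)
    then show "x i powr c \<le> x i * (\<Sum>i\<in>I. x i) powr (c - 1)"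
      using assms i by (simp add: split mult_left_mono powr_mono2)
  qed
  also have "\<dots> = (\<Sum>i\<in>I. x i) powr c"
    using assms by (simp add: split sum_nonneg flip: sum_distrib_right)
  finally show ?thesis .
qed

text \<open>The map \<open>c\<close> splits \<open>P\<close> into fibres. The conjugate exponent of
  \<open>t / a\<close> is \<open>b / a\<close>, so by duality the weighted estimate controls the
  l_(b/a) norm of the fibre sums of \<open>B powr a\<close>. Inside each fibre, l_a is contained in
  l_b with norm 1.\<close>

lemma remove_weight:
  fixes B :: "'p \<Rightarrow> real" and c :: "'p \<Rightarrow> 'l"
  assumes fin: "finite P" "finite L" "c ` P \<subseteq> L"
    and B: "\<And>p. p \<in> P \<Longrightarrow> 0 \<le> B p" and M: "0 \<le> M"
    and abt: "0 < a" "0 < b" "0 < t" "1 / b = 1 / a - 1 / t"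
    and weighted: "\<And>w. (\<And>l. 0 \<le> w l) \<Longrightarrow>
      (\<Sum>p\<in>P. (w (c p) * B p) powr a) \<le> (M * (\<Sum>l\<in>L. w l powr t) powr (1 / t)) powr a"
  shows "(\<Sum>p\<in>P. B p powr b) \<le> M powr b"
proof -
  define D where "D l = (\<Sum>p\<in>{p \<in> P. c p = l}. B p powr a)" for l
  define S where "S = (\<Sum>l\<in>L. D l powr (b / a))"
  \<comment> \<open>the weight with equality in Hoelder's inequality between \<open>w powr a\<close> and \<open>D\<close>\<close>
  define w where "w l = D l powr (b / (a * t))" for l
  have D0: "0 \<le> D l" for l by (simp add: D_def sum_nonneg)
  have S0: "0 \<le> S" by (simp add: S_def sum_nonneg)
  have ba: "b / a = 1 + b / t" "a / b = 1 - a / t"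
    using abt by (simp_all add: field_simps)
  have "S = (\<Sum>l\<in>L. w l powr a * D l)"
    unfolding S_def
  proof (rule sum.cong)
    fix l
    show "D l powr (b / a) = w l powr a * D l"
      using D0[of l] abt(1) by (cases "D l = 0") (auto simp: w_def powr_powr ba powr_add)
  qed simp
  also have "\<dots> = (\<Sum>l\<in>L. \<Sum>p\<in>{p \<in> P. c p = l}. (w (c p) * B p) powr a)"
    using B by (auto simp: D_def sum_distrib_left powr_mult w_def intro!: sum.cong)
  also have "\<dots> = (\<Sum>p\<in>P. (w (c p) * B p) powr a)"
    using fin by (rule sum.group)
  also have "\<dots> \<le> (M * (\<Sum>l\<in>L. w l powr t) powr (1 / t)) powr a"
    by (rule weighted) (simp add: w_def)
  \<comment> \<open>The t-th powers of the extremal weight are \<open>D l powr (b / a)\<close>, so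
    they add up to \<open>S\<close> again.\<close>
  also have "\<dots> = M powr a * S powr (a / t)"
    using abt M by (simp add: w_def S_def powr_powr powr_mult mult.commute)
  finally have S: "S \<le> M powr a * S powr (a / t)" .
  have "S \<le> M powr b"
  \<comment> \<open>A nonzero \<open>S\<close> may be divided by \<open>S powr (a / t)\<close>,
    which leaves the exponent \<open>1 - a / t = a / b\<close>.\<close>
  proof (cases "S = 0")
    case False
    then have "S powr (a / b) \<le> M powr a"
      using S S0 by (simp add: ba powr_diff field_simps)
    then have "(S powr (a / b)) powr (b / a) \<le> (M powr a) powr (b / a)"
      using abt by (intro powr_mono2) auto
    then show ?thesis using abt S0 by (simp add: powr_powr)
  qed simp
  have "(\<Sum>p\<in>P. B p powr b) = (\<Sum>l\<in>L. \<Sum>p\<in>{p \<in> P. c p = l}. B p powr b)"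
    using fin by (rule sum.group[symmetric])
  also have "\<dots> = (\<Sum>l\<in>L. \<Sum>p\<in>{p \<in> P. c p = l}. (B p powr a) powr (b / a))"
    using abt by (simp add: powr_powr)
  \<comment> \<open>Here \<open>b / a = 1 + b / t\<close> is at least 1.\<close>
  also have "\<dots> \<le> S"
    unfolding S_def D_def using fin abt ba
    by (intro sum_mono sum_powr_le_powr_sum) auto
  also note \<open>S \<le> M powr b\<close>
  finally show ?thesis .
qed

text \<open>Induction on the set of weighted coordinates. A weight fixed in the new coordinate is
  absorbed into \<open>B\<close> and its l_t norm into \<open>M\<close>, so the induction hypothesis
  frees the other coordinates. Since that weight was arbitrary, \<open>remove_weight\<close> then
  frees the last one.\<close>

lemma remove_weights:
  fixes B :: "'p \<Rightarrow> real" and c :: "'k \<Rightarrow> 'p \<Rightarrow> 'l"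
  assumes "finite J"
    and "finite P" "finite L" "\<And>k. k \<in> J \<Longrightarrow> c k ` P \<subseteq> L"
    and "0 < a" "0 < b" "0 < t" "1 / b = 1 / a - real (card J) / t"
    and "\<And>p. p \<in> P \<Longrightarrow> 0 \<le> B p" "0 \<le> M"
    and "\<And>w. (\<And>k l. 0 \<le> w k l) \<Longrightarrow>
      (\<Sum>p\<in>P. ((\<Prod>k\<in>J. w k (c k p)) * B p) powr a)
        \<le> (M * (\<Prod>k\<in>J. (\<Sum>l\<in>L. w k l powr t) powr (1 / t))) powr a"
  shows "(\<Sum>p\<in>P. B p powr b) \<le> M powr b"
  using assms
proof (induction J arbitrary: B M b)
  case empty
  \<comment> \<open>Both products are empty and the exponent relation reads \<open>b = a\<close>, so
    any weight will do.\<close>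
  from empty.prems(10)[of "\<lambda>_ _. 0"] show ?case using empty.prems by simp
next
  case (insert k J)
  \<comment> \<open>The exponent reached once the coordinates in \<open>J\<close> are free and only
    \<open>k\<close> still carries a weight.\<close>
  define b' where "b' = 1 / (1 / b + 1 / t)"
  have b': "0 < b'" "1 / b' = 1 / b + 1 / t"
  proof -
    have "0 < 1 / b + 1 / t" using insert.prems(5,6) by (simp add: add_pos_pos)
    then show "0 < b'" "1 / b' = 1 / b + 1 / t" by (simp_all add: b'_def)
  qed
  have "(\<Sum>p\<in>P. (w (c k p) * B p) powr b') \<le> (M * (\<Sum>l\<in>L. w l powr t) powr (1 / t)) powr b'"
    if w: "\<And>l. 0 \<le> w l" for w
  proof (rule insert.IH)
    show "1 / b' = 1 / a - real (card J) / t"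
      using insert by (simp add: b' add_divide_distrib)
    show "(\<Sum>p\<in>P. ((\<Prod>i\<in>J. v i (c i p)) * (w (c k p) * B p)) powr a)
      \<le> (M * (\<Sum>l\<in>L. w l powr t) powr (1 / t) * (\<Prod>i\<in>J. (\<Sum>l\<in>L. v i l powr t) powr (1 / t))) powr a"
      if v: "\<And>i l. 0 \<le> v i l" for v
    proof -
      \<comment> \<open>Since \<open>k\<close> lies outside \<open>J\<close>, attaching
        \<open>w\<close> to coordinate \<open>k\<close> does not disturb the product over
        \<open>J\<close>.\<close>
      have "(\<Prod>i\<in>J. f ((v(k := w)) i) i) = (\<Prod>i\<in>J. f (v i) i)" for f :: "_ \<Rightarrow> _ \<Rightarrow> real"
        using insert.hyps by (intro prod.cong) auto
      note this[of "\<lambda>z i. z (c i _)"] this[of "\<lambda>z i. (\<Sum>l\<in>L. z l powr t) powr (1 / t)"]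
      then show ?thesis
        using insert.prems(10)[of "v(k := w)"] insert.hyps v w by (simp add: mult_ac)
    qed
  qed (use insert.prems b' w in auto)
  then show ?case
    using insert.prems b' by (intro remove_weight[of P L "c k" B M b' b t]) auto
qed


section \<open>Estimates of weak norms through partial sums, and functionals of norm 1\<close>

section \<open>Weakly summable sequences and functionals\<close>

lemma scalars_simps [simp]:
  "carrier (scalars K) = K" "x \<otimes>\<^bsub>scalars K\<^esub> y = x * y" "x \<oplus>\<^bsub>scalars K\<^esub> y = x + y"
  "\<one>\<^bsub>scalars K\<^esub> = 1" "\<zero>\<^bsub>scalars K\<^esub> = 0"
  by (simp_all add: scalars_def)

lemma prod_powr:
  fixes f :: "'i \<Rightarrow> real"
  assumes "\<And>i. i \<in> I \<Longrightarrow> 0 \<le> f i"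
  shows "(\<Prod>i\<in>I. f i) powr c = (\<Prod>i\<in>I. f i powr c)"
  using assms by (induction I rule: infinite_finite_induct) (simp_all add: powr_mult prod_nonneg)

lemma dual_ballD:
  assumes "\<phi> \<in> dual_ball K E"
  shows "x \<in> carrier E \<Longrightarrow> \<phi> x \<in> K"
    and "x \<in> carrier E \<Longrightarrow> y \<in> carrier E \<Longrightarrow> \<phi> (x \<oplus>\<^bsub>E\<^esub> y) = \<phi> x + \<phi> y"
    and "c \<in> K \<Longrightarrow> x \<in> carrier E \<Longrightarrow> \<phi> (c \<odot>\<^bsub>E\<^esub> x) = c * \<phi> x"
    and "x \<in> carrier E \<Longrightarrow> cmod (\<phi> x) \<le> \<parallel>x\<parallel>\<^bsub>E\<^esub>"
  using assms by (auto simp: dual_ball_def)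

lemma weak_lp_carrier: "x \<in> weak_lp K p E \<Longrightarrow> x j \<in> carrier E"
  by (auto simp: weak_lp_def)

text \<open>Together with \<open>weak_lpI\<close>, this replaces series and suprema by partial sums
  for a single functional.\<close>

lemma sum_le_weak_norm:
  assumes x: "x \<in> weak_lp K p E" and \<phi>: "\<phi> \<in> dual_ball K E" and "0 < p"
  shows "(\<Sum>j<n. cmod (\<phi> (x j)) powr p) \<le> weak_norm K p E x powr p"
proof -
  have summable: "summable (\<lambda>j. cmod (\<phi> (x j)) powr p)"
    using x \<phi> by (auto simp: weak_lp_def)
  have "(\<Sum>j. cmod (\<phi> (x j)) powr p) powr (1 / p) \<le> weak_norm K p E x"
    using x \<phi> unfolding weak_lp_def weak_norm_def by (intro cSUP_upper) auto
  then have "((\<Sum>j. cmod (\<phi> (x j)) powr p) powr (1 / p)) powr p \<le> weak_norm K p E x powr p"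
    using \<open>0 < p\<close> by (intro powr_mono2) auto
  moreover have "(\<Sum>j<n. cmod (\<phi> (x j)) powr p) \<le> (\<Sum>j. cmod (\<phi> (x j)) powr p)"
    using summable by (rule sum_le_suminf) auto
  ultimately show ?thesis
    using \<open>0 < p\<close> summable by (simp add: powr_powr suminf_nonneg)
qed

context banach_space
begin

lemma scalar_mult_closed: "a \<in> K \<Longrightarrow> b \<in> K \<Longrightarrow> a * b \<in> K"
  using R.m_closed by simp

text \<open>Keeps the supremum in \<open>weak_norm\<close> over a nonempty set, even if the dual
  space is trivial, and makes it nonnegative.\<close>

lemma zero_functional_in_dual_ball: "(\<lambda>_. 0) \<in> dual_ball K E"
  using R.zero_closed vnorm_nonneg by (simp add: dual_ball_def)

lemma weak_lpI:
  assumes x: "\<And>j. x j \<in> carrier E" and "0 < p" "0 \<le> W"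
    and W: "\<And>\<phi> n. \<phi> \<in> dual_ball K E \<Longrightarrow> (\<Sum>j<n. cmod (\<phi> (x j)) powr p) \<le> W powr p"
  shows "x \<in> weak_lp K p E" "weak_norm K p E x \<le> W"
proof -
  have summable: "summable (\<lambda>j. cmod (\<phi> (x j)) powr p)" if "\<phi> \<in> dual_ball K E" for \<phi>
    using W[OF that] by (intro summableI_nonneg_bounded[where x = "W powr p"]) auto
  have le: "(\<Sum>j. cmod (\<phi> (x j)) powr p) powr (1 / p) \<le> W" if \<phi>: "\<phi> \<in> dual_ball K E" for \<phi>
  proof -
    have "(\<Sum>j. cmod (\<phi> (x j)) powr p) \<le> W powr p"
      using summable[OF \<phi>] W[OF \<phi>] by (rule suminf_le_const)
    then have "(\<Sum>j. cmod (\<phi> (x j)) powr p) powr (1 / p) \<le> (W powr p) powr (1 / p)"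
      using \<open>0 < p\<close> summable[OF \<phi>] by (intro powr_mono2) (auto simp: suminf_nonneg)
    then show ?thesis using \<open>0 < p\<close> \<open>0 \<le> W\<close> by (simp add: powr_powr)
  qed
  show "x \<in> weak_lp K p E"
    using x summable le by (auto simp: weak_lp_def intro!: bdd_aboveI2[where M = W])
  show "weak_norm K p E x \<le> W"
    unfolding weak_norm_def using zero_functional_in_dual_ball le by (intro cSUP_least) auto
qed

lemma weak_norm_nonneg:
  assumes "x \<in> weak_lp K p E"
  shows "0 \<le> weak_norm K p E x"
proof -
  have "0 \<le> (\<Sum>j. cmod ((\<lambda>_. 0) (x j)) powr p) powr (1 / p)" by simp
  also have "\<dots> \<le> weak_norm K p E x"
    unfolding weak_norm_def using assms zero_functional_in_dual_ball
    by (intro cSUP_upper) (auto simp: weak_lp_def)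
  finally show ?thesis .
qed

text \<open>Hoelder's inequality for each functional, with \<open>s / t + s / u = 1\<close>. Weights
  of finite support suffice, and their l_t norms are finite sums.\<close>

lemma weak_lp_scaled:
  assumes K: "\<real> \<subseteq> K" and x: "x \<in> weak_lp K u E"
    and su: "0 < s" "s < u" and t: "1 / t = 1 / s - 1 / u"
    and w: "\<And>j. 0 \<le> w j" "\<And>j. n \<le> j \<Longrightarrow> w j = 0"
  shows "(\<lambda>j. of_real (w j) \<odot> x j) \<in> weak_lp K s E" (is ?lp)
    and "weak_norm K s E (\<lambda>j. of_real (w j) \<odot> x j)
      \<le> (\<Sum>j<n. w j powr t) powr (1 / t) * weak_norm K u E x" (is ?le)
proof -
  have wK: "of_real (w j) \<in> K" for j using K by auto
  have t0: "0 < t"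
  proof -
    have "0 < 1 / t" using su by (simp add: t field_simps)
    then show ?thesis by simp
  qed
  have exponents: "0 < s / t" "0 < s / u" "s / t + s / u = 1"
  proof -
    have "s / t = s * (1 / t)" by simp
    also have "\<dots> = 1 - s / u" using su by (simp add: t right_diff_distrib)
    finally show "s / t + s / u = 1" by simp
  qed (use t0 su in auto)
  have bound: "(\<Sum>j<k. cmod (\<phi> (of_real (w j) \<odot> x j)) powr s)
      \<le> ((\<Sum>j<n. w j powr t) powr (1 / t) * weak_norm K u E x) powr s"
    if \<phi>: "\<phi> \<in> dual_ball K E" for \<phi> k
  proof -
    \<comment> \<open>Enlarging the range to \<open>max k n\<close> lets it be cut back to
      \<open>n\<close>, where the support of \<open>w\<close> ends, whichever of \<open>k\<close>
      and \<open>n\<close> is larger.\<close>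
    have "(\<Sum>j<k. cmod (\<phi> (of_real (w j) \<odot> x j)) powr s)
        \<le> (\<Sum>j<max k n. cmod (\<phi> (of_real (w j) \<odot> x j)) powr s)"
      by (intro sum_mono2) auto
    also have "\<dots> = (\<Sum>j<max k n. (w j * cmod (\<phi> (x j))) powr s)"
      using w wK x by (simp add: dual_ballD[OF \<phi>] weak_lp_carrier norm_mult)
    also have "\<dots> = (\<Sum>j<n. (w j * cmod (\<phi> (x j))) powr s)"
      using w by (intro sum.mono_neutral_right) auto
    also have "\<dots> = (\<Sum>j<n. (w j powr t) powr (s / t) * (cmod (\<phi> (x j)) powr u) powr (s / u))"
      using w t0 su by (simp add: powr_powr powr_mult)
    also have "\<dots> \<le> (\<Sum>j<n. w j powr t) powr (s / t) * (\<Sum>j<n. cmod (\<phi> (x j)) powr u) powr (s / u)"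
      using exponents by (intro sum_powr_mult_powr_le) auto
    also have "\<dots> \<le> (\<Sum>j<n. w j powr t) powr (s / t) * (weak_norm K u E x powr u) powr (s / u)"
      using x \<phi> su by (intro mult_left_mono powr_mono2 sum_le_weak_norm) (auto intro: sum_nonneg)
    also have "\<dots> = ((\<Sum>j<n. w j powr t) powr (1 / t) * weak_norm K u E x) powr s"
      using su weak_norm_nonneg[OF x] by (simp add: powr_mult powr_powr)
    finally show ?thesis .
  qed
  have "of_real (w j) \<odot> x j \<in> carrier E" for j
    using wK x by (intro smult_closed) (auto simp: weak_lp_carrier)
  then show ?lp ?le
    using su weak_norm_nonneg[OF x]
    by (intro weak_lpI[OF _ _ _ bound]; simp)+
qed

text \<open>Along one vector the weak norm splits into the l_p norm of the weight and the size of
  the functionals at \<open>a\<close>. Bounding the latter by \<open>b\<close>, not by the norm of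
  \<open>a\<close>, permits \<open>b = 0\<close> when no functional sees \<open>a\<close>.\<close>

lemma weak_lp_constant_direction:
  assumes K: "\<real> \<subseteq> K" and a: "a \<in> carrier E" and "0 < p"
    and w: "\<And>j. 0 \<le> w j" and W: "0 \<le> W" "\<And>n. (\<Sum>j<n. w j powr p) \<le> W powr p"
    and b: "\<And>\<phi>. \<phi> \<in> dual_ball K E \<Longrightarrow> cmod (\<phi> a) \<le> b"
  shows "(\<lambda>j. of_real (w j) \<odot> a) \<in> weak_lp K p E" (is ?lp)
    and "weak_norm K p E (\<lambda>j. of_real (w j) \<odot> a) \<le> W * b" (is ?le)
proof -
  have wK: "of_real (w j) \<in> K" for j using K by auto
  have "0 \<le> b" using b[OF zero_functional_in_dual_ball] by simp
  have bound: "(\<Sum>j<n. cmod (\<phi> (of_real (w j) \<odot> a)) powr p) \<le> (W * b) powr p"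
    if \<phi>: "\<phi> \<in> dual_ball K E" for \<phi> n
  proof -
    have "(\<Sum>j<n. cmod (\<phi> (of_real (w j) \<odot> a)) powr p) = (\<Sum>j<n. w j powr p) * cmod (\<phi> a) powr p"
      using w wK a by (simp add: dual_ballD[OF \<phi>] norm_mult powr_mult sum_distrib_right)
    also have "\<dots> \<le> W powr p * b powr p"
      using W b[OF \<phi>] \<open>0 < p\<close> by (intro mult_mono powr_mono2) (auto intro: sum_nonneg)
    finally show ?thesis using W \<open>0 \<le> b\<close> by (simp add: powr_mult)
  qed
  have "of_real (w j) \<odot> a \<in> carrier E" for j
    using wK a by (intro smult_closed) auto
  then show ?lp ?le
    using \<open>0 < p\<close> W \<open>0 \<le> b\<close>
    by (intro weak_lpI[OF _ _ _ bound]; simp)+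
qed

text \<open>A nonzero functional is divided by its norm \<open>L\<close>. The supremum defining
  \<open>L\<close> need not be attained, hence the formulation with \<open>d < 1\<close>.\<close>

lemma norming_functional:
  assumes K: "\<real> \<subseteq> K" and \<phi>: "\<phi> \<in> dual_ball K E" and a: "a \<in> carrier E" "\<phi> a \<noteq> 0"
  obtains \<psi> where "\<psi> \<in> dual_ball K E"
    "\<And>d. d < 1 \<Longrightarrow> \<exists>x\<in>carrier E. 0 < \<parallel>x\<parallel> \<and> d * \<parallel>x\<parallel> < cmod (\<psi> x)"
proof -
  \<comment> \<open>Positive norm keeps the quotients meaningful; on the remaining vectors the norm
    is 0 and \<open>\<phi>\<close> vanishes.\<close>
  define X where "X = {x \<in> carrier E. 0 < \<parallel>x\<parallel>}"
  define L where "L = (SUP x\<in>X. cmod (\<phi> x) / \<parallel>x\<parallel>)"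
  have aX: "a \<in> X"
    using a dual_ballD(4)[OF \<phi>, of a] by (auto simp: X_def intro: less_le_trans[of _ "cmod (\<phi> a)"])
  have bdd: "bdd_above ((\<lambda>x. cmod (\<phi> x) / \<parallel>x\<parallel>) ` X)"
    using dual_ballD(4)[OF \<phi>] by (intro bdd_aboveI2[of _ _ 1]) (auto simp: X_def)
  have "0 < cmod (\<phi> a) / \<parallel>a\<parallel>" using a aX by (simp add: X_def)
  also have "\<dots> \<le> L" unfolding L_def using aX bdd by (rule cSUP_upper)
  finally have L: "0 < L" .
  have le: "cmod (\<phi> x) \<le> L * \<parallel>x\<parallel>" if "x \<in> carrier E" for x
  proof (cases "x \<in> X")
    case True
    then have "cmod (\<phi> x) / \<parallel>x\<parallel> \<le> L" unfolding L_def using bdd by (rule cSUP_upper)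
    then show ?thesis using True by (simp add: X_def field_simps)
  next
    case False
    then have "\<parallel>x\<parallel> = 0" using that vnorm_nonneg[OF that] by (auto simp: X_def)
    then show ?thesis using dual_ballD(4)[OF \<phi> that] by simp
  qed
  define \<psi> where "\<psi> x = of_real (1 / L) * \<phi> x" for x
  have LK: "of_real (1 / L) \<in> K" using K Reals_of_real by (rule subsetD)
  have "\<psi> \<in> dual_ball K E"
  proof -
    have "\<psi> x \<in> K" if "x \<in> carrier E" for x
      unfolding \<psi>_def using LK dual_ballD(1)[OF \<phi> that] by (rule scalar_mult_closed)
    moreover have "cmod (\<psi> x) \<le> \<parallel>x\<parallel>" if "x \<in> carrier E" for x
      using le[OF that] L by (simp add: \<psi>_def norm_mult norm_divide field_simps)
    ultimately show ?thesis
      by (simp add: dual_ball_def \<psi>_def dual_ballD[OF \<phi>] distrib_left mult.left_commute)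
  qed
  moreover have "\<exists>x\<in>carrier E. 0 < \<parallel>x\<parallel> \<and> d * \<parallel>x\<parallel> < cmod (\<psi> x)" if "d < 1" for d
  proof -
    \<comment> \<open>Thus \<open>d * L\<close> is no upper bound of the quotients, and some vector
      exceeds it.\<close>
    have "d * L < L" using that L by simp
    then obtain x where "x \<in> X" "d * L < cmod (\<phi> x) / \<parallel>x\<parallel>"
      unfolding L_def using aX bdd by (subst (asm) less_cSUP_iff) auto
    then show ?thesis
      using L by (intro bexI[of _ x]) (auto simp: X_def \<psi>_def norm_mult norm_divide field_simps)
  qed
  ultimately show ?thesis by (rule that)
qed

end


section \<open>The summing inequality on finite cubes of indices, and its test sequences\<close>

section \<open>Multiple summing operators\<close>

lemma finite_subset_PiE_lessThan:
  assumes "finite I" "finite G" "G \<subseteq> I \<rightarrow>\<^sub>E (UNIV :: nat set)"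
  obtains n where "G \<subseteq> I \<rightarrow>\<^sub>E {..<n}"
proof -
  have "finite (\<Union>j\<in>G. j ` I)" using assms by auto
  then obtain n where "(\<Union>j\<in>G. j ` I) \<subseteq> {..<n}" by (meson finite_nat_iff_bounded)
  then show ?thesis using assms by (intro that[of n]) (auto simp: PiE_iff subset_iff)
qed

lemma tuples_update: "x \<in> tuples m E \<Longrightarrow> k \<in> {1..m} \<Longrightarrow> a \<in> carrier (E k) \<Longrightarrow> x(k := a) \<in> tuples m E"
  by (auto simp: tuples_def PiE_iff extensional_def)

lemma tuples_restrict: "x \<in> tuples m E \<Longrightarrow> (\<lambda>k\<in>{1..m}. x k) = x"
  by (simp add: tuples_def PiE_restrict)

lemma restrict_in_tuples: "(\<And>k. k \<in> {1..m} \<Longrightarrow> x k \<in> carrier (E k)) \<Longrightarrow> (\<lambda>k\<in>{1..m}. x k) \<in> tuples m E"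
  by (simp add: tuples_def)

lemma tuples_carrier: "x \<in> tuples m E \<Longrightarrow> k \<in> {1..m} \<Longrightarrow> x k \<in> carrier (E k)"
  by (auto simp: tuples_def)

locale banach_family =
  fixes K :: "complex set" and m :: nat and E :: "nat \<Rightarrow> 'a normed_space" and F :: "'b normed_space"
  assumes real_scalars: "\<real> \<subseteq> K"
    and domain: "k \<in> {1..m} \<Longrightarrow> banach_space K (E k)"
    and codomain: "banach_space K F"
begin

sublocale F: banach_space K F by (rule codomain)

lemma scalar_of_real: "of_real c \<in> K"
  using real_scalars Reals_of_real by (rule subsetD)

lemma prod_weak_norm_nonneg:
  assumes "\<And>k. k \<in> {1..m} \<Longrightarrow> x k \<in> weak_lp K p (E k)"
  shows "0 \<le> (\<Prod>k=1..m. weak_norm K p (E k) (x k))"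
  using assms by (intro prod_nonneg) (auto intro: banach_space.weak_norm_nonneg[OF domain])

text \<open>The summands are nonnegative and every finite set of multi-indices lies in a cube, so a
  uniform bound on cubes yields both summability and the bound on the sum.\<close>

lemma summing_boundI:
  assumes "0 < C" "0 < q"
    and le: "\<And>x n. (\<And>k. k \<in> {1..m} \<Longrightarrow> x k \<in> weak_lp K p (E k)) \<Longrightarrow>
      (\<Sum>j\<in>{1..m} \<rightarrow>\<^sub>E {..<n}. \<parallel>T (\<lambda>k\<in>{1..m}. x k (j k))\<parallel>\<^bsub>F\<^esub> powr q)
        \<le> (C * (\<Prod>k=1..m. weak_norm K p (E k) (x k))) powr q"
  shows "summing_bound K m E F q p T C"
  unfolding summing_bound_def
proof (intro conjI allI impI)
  fix x assume "\<forall>k\<in>{1..m}. x k \<in> weak_lp K p (E k)"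
  then have x: "\<And>k. k \<in> {1..m} \<Longrightarrow> x k \<in> weak_lp K p (E k)" by blast
  let ?f = "\<lambda>j. \<parallel>T (\<lambda>k\<in>{1..m}. x k (j k))\<parallel>\<^bsub>F\<^esub> powr q"
  let ?R = "C * (\<Prod>k=1..m. weak_norm K p (E k) (x k))"
  have finite_le: "sum ?f G \<le> ?R powr q" if G: "finite G" "G \<subseteq> {1..m} \<rightarrow>\<^sub>E UNIV" for G
  proof -
    obtain n where "G \<subseteq> {1..m} \<rightarrow>\<^sub>E {..<n}"
      using finite_subset_PiE_lessThan[OF finite_atLeastAtMost G] by blast
    then have "sum ?f G \<le> sum ?f ({1..m} \<rightarrow>\<^sub>E {..<n})"
      by (intro sum_mono2) (auto intro: finite_PiE)
    also have "\<dots> \<le> ?R powr q"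
      using x by (rule le)
    finally show ?thesis .
  qed
  show summable: "?f summable_on ({1..m} \<rightarrow>\<^sub>E UNIV)"
    using finite_le by (intro nonneg_bdd_above_summable_on bdd_aboveI2[where M = "?R powr q"]) auto
  have "infsum ?f ({1..m} \<rightarrow>\<^sub>E UNIV) powr (1 / q) \<le> (?R powr q) powr (1 / q)"
    using \<open>0 < q\<close> infsum_le_finite_sums[OF summable finite_le]
    by (intro powr_mono2 infsum_nonneg) auto
  then show "infsum ?f ({1..m} \<rightarrow>\<^sub>E UNIV) powr (1 / q) \<le> ?R"
    using assms(1,2) prod_weak_norm_nonneg[OF x] by (simp add: powr_powr)
qed (fact \<open>0 < C\<close>)

lemma summing_boundD:
  assumes bound: "summing_bound K m E F q p T C" and "0 < q"
    and x: "\<And>k. k \<in> {1..m} \<Longrightarrow> x k \<in> weak_lp K p (E k)"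
  shows "(\<Sum>j\<in>{1..m} \<rightarrow>\<^sub>E {..<n}. \<parallel>T (\<lambda>k\<in>{1..m}. x k (j k))\<parallel>\<^bsub>F\<^esub> powr q)
    \<le> (C * (\<Prod>k=1..m. weak_norm K p (E k) (x k))) powr q"
proof -
  let ?f = "\<lambda>j. \<parallel>T (\<lambda>k\<in>{1..m}. x k (j k))\<parallel>\<^bsub>F\<^esub> powr q"
  let ?R = "C * (\<Prod>k=1..m. weak_norm K p (E k) (x k))"
  have summable: "?f summable_on ({1..m} \<rightarrow>\<^sub>E UNIV)"
    and le: "infsum ?f ({1..m} \<rightarrow>\<^sub>E UNIV) powr (1 / q) \<le> ?R"
    using bound x by (auto simp: summing_bound_def)
  have "sum ?f ({1..m} \<rightarrow>\<^sub>E {..<n}) \<le> infsum ?f ({1..m} \<rightarrow>\<^sub>E UNIV)"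
    using summable by (intro finite_sum_le_infsum) (auto intro: finite_PiE)
  also have "\<dots> = (infsum ?f ({1..m} \<rightarrow>\<^sub>E UNIV) powr (1 / q)) powr q"
    using \<open>0 < q\<close> by (simp add: powr_powr infsum_nonneg)
  also have "\<dots> \<le> ?R powr q"
    using \<open>0 < q\<close> le by (intro powr_mono2) auto
  finally show ?thesis .
qed

lemma bounded_multilinear_closed:
  "T \<in> bounded_multilinear K m E F \<Longrightarrow> x \<in> tuples m E \<Longrightarrow> T x \<in> carrier F"
  by (auto simp: bounded_multilinear_def)

lemma norm_multilinear_scaled:
  assumes T: "T \<in> bounded_multilinear K m E F" and x: "x \<in> tuples m E"
    and c: "\<And>k. k \<in> {1..m} \<Longrightarrow> c k \<in> K"
  shows "\<parallel>T (\<lambda>k\<in>{1..m}. c k \<odot>\<^bsub>E k\<^esub> x k)\<parallel>\<^bsub>F\<^esub> = (\<Prod>k=1..m. cmod (c k)) * \<parallel>T x\<parallel>\<^bsub>F\<^esub>"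
proof -
  \<comment> \<open>\<open>J\<close> collects the coordinates already scaled; homogeneity in one
    further coordinate is the induction step.\<close>
  have "\<parallel>T (\<lambda>k\<in>{1..m}. if k \<in> J then c k \<odot>\<^bsub>E k\<^esub> x k else x k)\<parallel>\<^bsub>F\<^esub>
      = (\<Prod>k\<in>J. cmod (c k)) * \<parallel>T x\<parallel>\<^bsub>F\<^esub>" if "J \<subseteq> {1..m}" for J
    using finite_subset[OF that finite_atLeastAtMost] that
  proof (induction J rule: finite_induct)
    case empty
    then show ?case using tuples_restrict[OF x] by simp
  next
    case (insert i J)
    define y where "y = (\<lambda>k\<in>{1..m}. if k \<in> J then c k \<odot>\<^bsub>E k\<^esub> x k else x k)"
    have i: "i \<in> {1..m}" using insert.prems by simp
    have y: "y \<in> tuples m E"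
      unfolding y_def
    proof (rule restrict_in_tuples)
      fix k assume k: "k \<in> {1..m}"
      interpret banach_space K "E k" using k by (rule domain)
      show "(if k \<in> J then c k \<odot>\<^bsub>E k\<^esub> x k else x k) \<in> carrier (E k)"
        using smult_closed[of "c k" "x k"] c[OF k] tuples_carrier[OF x k] by simp
    qed
    have "(\<lambda>k\<in>{1..m}. if k \<in> insert i J then c k \<odot>\<^bsub>E k\<^esub> x k else x k) = y(i := c i \<odot>\<^bsub>E i\<^esub> x i)"
      using i by (auto simp: y_def)
    moreover have "T (y(i := c i \<odot>\<^bsub>E i\<^esub> x i)) = c i \<odot>\<^bsub>F\<^esub> T (y(i := x i))"
      using T y i c tuples_carrier[OF x i] by (simp add: bounded_multilinear_def)
    moreover have "y(i := x i) = y"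
      using i insert.hyps by (auto simp: y_def)
    ultimately have "\<parallel>T (\<lambda>k\<in>{1..m}. if k \<in> insert i J then c k \<odot>\<^bsub>E k\<^esub> x k else x k)\<parallel>\<^bsub>F\<^esub>
        = cmod (c i) * \<parallel>T y\<parallel>\<^bsub>F\<^esub>"
      using c[OF i] bounded_multilinear_closed[OF T y] by (simp only: F.vnorm_smult)
    also have "\<parallel>T y\<parallel>\<^bsub>F\<^esub> = (\<Prod>k\<in>J. cmod (c k)) * \<parallel>T x\<parallel>\<^bsub>F\<^esub>"
      using insert unfolding y_def by blast
    finally show ?case
      using insert.hyps by simp
  qed
  from this[of "{1..m}"] show ?thesis by (simp cong: restrict_cong)
qed

text \<open>The inequality for \<open>(r;s)\<close> is applied to the weighted sequences, whose weak
  s-norms \<open>weak_lp_scaled\<close> controls. Removing the \<open>m\<close> weights turns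
  \<open>r\<close> into \<open>q\<close>, and the constant \<open>C\<close> survives.\<close>

lemma summing_bound_inclusion:
  assumes T: "T \<in> bounded_multilinear K m E F" and bound: "summing_bound K m E F r s T C"
    and su: "0 < s" "s < u" and rq: "0 < r" "0 < q" "1 / q = 1 / r - real m * (1 / s - 1 / u)"
  shows "summing_bound K m E F q u T C"
proof (rule summing_boundI)
  show C: "0 < C" using bound by (simp add: summing_bound_def)
  fix x :: "nat \<Rightarrow> nat \<Rightarrow> 'a" and n :: nat
  assume x: "\<And>k. k \<in> {1..m} \<Longrightarrow> x k \<in> weak_lp K u (E k)"
  define t where "t = 1 / (1 / s - 1 / u)"
  have t: "1 / t = 1 / s - 1 / u" "0 < t"
    using su by (auto simp: t_def field_simps)
  let ?P = "{1..m} \<rightarrow>\<^sub>E {..<n}"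
  let ?M = "C * (\<Prod>k=1..m. weak_norm K u (E k) (x k))"
  have x_carrier: "x k j \<in> carrier (E k)" if "k \<in> {1..m}" for k j
    using x[OF that] by (rule weak_lp_carrier)
  have weighted: "(\<Sum>j\<in>?P. ((\<Prod>k=1..m. w k (j k)) * \<parallel>T (\<lambda>k\<in>{1..m}. x k (j k))\<parallel>\<^bsub>F\<^esub>) powr r)
      \<le> (?M * (\<Prod>k=1..m. (\<Sum>l<n. w k l powr t) powr (1 / t))) powr r"
    if w: "\<And>k l. 0 \<le> w k l" for w
  proof -
    \<comment> \<open>The weights to be tested are arbitrary, while \<open>weak_lp_scaled\<close>
      needs finite support. Cutting at \<open>n\<close> changes nothing on the cube.\<close>
    define v where "v k l = (if l < n then w k l else 0)" for k l
    define y where "y k l = of_real (v k l) \<odot>\<^bsub>E k\<^esub> x k l" for k l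
    have y: "y k \<in> weak_lp K s (E k)"
      "weak_norm K s (E k) (y k) \<le> (\<Sum>l<n. w k l powr t) powr (1 / t) * weak_norm K u (E k) (x k)"
      if k: "k \<in> {1..m}" for k
    proof -
      interpret banach_space K "E k" using k by (rule domain)
      have v: "\<And>l. 0 \<le> v k l" "\<And>l. n \<le> l \<Longrightarrow> v k l = 0" using w by (auto simp: v_def)
      show "y k \<in> weak_lp K s (E k)"
        using weak_lp_scaled(1)[OF real_scalars x[OF k] su t(1), of "v k" n] v
        by (simp add: y_def[abs_def])
      have "weak_norm K s (E k) (y k)
          \<le> (\<Sum>l<n. v k l powr t) powr (1 / t) * weak_norm K u (E k) (x k)"
        using weak_lp_scaled(2)[OF real_scalars x[OF k] su t(1), of "v k" n] v
        by (simp add: y_def[abs_def])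
      then show "weak_norm K s (E k) (y k)
          \<le> (\<Sum>l<n. w k l powr t) powr (1 / t) * weak_norm K u (E k) (x k)"
        by (simp add: v_def)
    qed
    have "(\<Sum>j\<in>?P. ((\<Prod>k=1..m. w k (j k)) * \<parallel>T (\<lambda>k\<in>{1..m}. x k (j k))\<parallel>\<^bsub>F\<^esub>) powr r)
        = (\<Sum>j\<in>?P. \<parallel>T (\<lambda>k\<in>{1..m}. y k (j k))\<parallel>\<^bsub>F\<^esub> powr r)"
    proof (rule sum.cong)
      fix j assume j: "j \<in> ?P"
      have "T (\<lambda>k\<in>{1..m}. y k (j k))
          = T (\<lambda>k\<in>{1..m}. of_real (v k (j k)) \<odot>\<^bsub>E k\<^esub> (\<lambda>k\<in>{1..m}. x k (j k)) k)"
        by (simp add: y_def cong: restrict_cong)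
      then have "\<parallel>T (\<lambda>k\<in>{1..m}. y k (j k))\<parallel>\<^bsub>F\<^esub>
          = (\<Prod>k=1..m. cmod (of_real (v k (j k)))) * \<parallel>T (\<lambda>k\<in>{1..m}. x k (j k))\<parallel>\<^bsub>F\<^esub>"
        using T x_carrier by (simp only:)
          (intro norm_multilinear_scaled restrict_in_tuples scalar_of_real)
      \<comment> \<open>Indices in the cube lie below \<open>n\<close>, where \<open>v\<close>
        agrees with \<open>w\<close>.\<close>
      also have "(\<Prod>k=1..m. cmod (of_real (v k (j k)))) = (\<Prod>k=1..m. w k (j k))"
        using j w by (intro prod.cong) (auto simp: v_def PiE_iff)
      finally show "((\<Prod>k=1..m. w k (j k)) * \<parallel>T (\<lambda>k\<in>{1..m}. x k (j k))\<parallel>\<^bsub>F\<^esub>) powr r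
          = \<parallel>T (\<lambda>k\<in>{1..m}. y k (j k))\<parallel>\<^bsub>F\<^esub> powr r" by (simp only:)
    qed simp
    also have "\<dots> \<le> (C * (\<Prod>k=1..m. weak_norm K s (E k) (y k))) powr r"
      using bound \<open>0 < r\<close> y(1) by (rule summing_boundD)
    also have "\<dots> \<le> (C * (\<Prod>k=1..m. (\<Sum>l<n. w k l powr t) powr (1 / t) * weak_norm K u (E k) (x k))) powr r"
      using C \<open>0 < r\<close> y prod_weak_norm_nonneg[of y s]
      by (intro powr_mono2 mult_left_mono prod_mono)
        (auto intro: banach_space.weak_norm_nonneg[OF domain])
    finally show ?thesis by (simp add: prod.distrib mult_ac)
  qed
  show "(\<Sum>j\<in>?P. \<parallel>T (\<lambda>k\<in>{1..m}. x k (j k))\<parallel>\<^bsub>F\<^esub> powr q) \<le> ?M powr q"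
  \<comment> \<open>The fibres for \<open>k\<close> are the slices of the cube with fixed k-th
    index.\<close>
  proof (rule remove_weights[where J = "{1..m}" and c = "\<lambda>k j. j k" and L = "{..<n}" and a = r and t = t])
    show "0 \<le> ?M" using C prod_weak_norm_nonneg[OF x] by simp
    show "1 / q = 1 / r - real (card {1..m}) / t"
      using rq(3) by (simp flip: t(1))
    show "0 \<le> \<parallel>T (\<lambda>k\<in>{1..m}. x k (j k))\<parallel>\<^bsub>F\<^esub>" for j
      using T x_carrier by (intro F.vnorm_nonneg bounded_multilinear_closed restrict_in_tuples)
  qed (use rq t weighted in \<open>auto intro: finite_PiE\<close>)
qed (fact rq)

text \<open>On the sequences \<open>w j\<close> times \<open>x k\<close> multilinearity separates
  the scalars from \<open>T x\<close>, and the sum over the cube becomes the m-th power of a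
  one-dimensional sum. This gives the test for both the pointwise bound and the exponents.\<close>

lemma summing_bound_constant_directions:
  fixes w :: "nat \<Rightarrow> real"
  assumes T: "T \<in> bounded_multilinear K m E F" and bound: "summing_bound K m E F q p T C"
    and qp: "0 < q" "0 < p" and x: "x \<in> tuples m E"
    and w: "\<And>j. 0 \<le> w j" and W: "0 \<le> W" "\<And>n. (\<Sum>j<n. w j powr p) \<le> W powr p"
    and b: "\<And>k \<phi>. k \<in> {1..m} \<Longrightarrow> \<phi> \<in> dual_ball K (E k) \<Longrightarrow> cmod (\<phi> (x k)) \<le> b k"
  shows "(\<Sum>l<n. w l powr q) ^ m * \<parallel>T x\<parallel>\<^bsub>F\<^esub> powr q \<le> (C * (\<Prod>k=1..m. W * b k)) powr q"
proof -
  define y where "y k j = of_real (w j) \<odot>\<^bsub>E k\<^esub> x k" for k and j :: nat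
  have C: "0 < C" using bound by (simp add: summing_bound_def)
  have y: "y k \<in> weak_lp K p (E k)" "weak_norm K p (E k) (y k) \<le> W * b k" if k: "k \<in> {1..m}" for k
    unfolding y_def[abs_def]
    using w W b[OF k]
    by (intro banach_space.weak_lp_constant_direction[OF domain[OF k] real_scalars tuples_carrier[OF x k] qp(2)]; blast)+
  have "(\<Sum>l<n. w l powr q) ^ m * \<parallel>T x\<parallel>\<^bsub>F\<^esub> powr q
      = (\<Sum>j\<in>{1..m} \<rightarrow>\<^sub>E {..<n}. (\<Prod>k=1..m. w (j k) powr q)) * \<parallel>T x\<parallel>\<^bsub>F\<^esub> powr q"
    using prod_sum_PiE[of "{1..m}" "\<lambda>_. {..<n}" "\<lambda>_ l. w l powr q"] by simp
  also have "\<dots> = (\<Sum>j\<in>{1..m} \<rightarrow>\<^sub>E {..<n}. \<parallel>T (\<lambda>k\<in>{1..m}. y k (j k))\<parallel>\<^bsub>F\<^esub> powr q)"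
    unfolding sum_distrib_right
  proof (rule sum.cong)
    fix j
    have "\<parallel>T (\<lambda>k\<in>{1..m}. y k (j k))\<parallel>\<^bsub>F\<^esub> = (\<Prod>k=1..m. cmod (of_real (w (j k)))) * \<parallel>T x\<parallel>\<^bsub>F\<^esub>"
      unfolding y_def using T x by (intro norm_multilinear_scaled scalar_of_real)
    then show "(\<Prod>k=1..m. w (j k) powr q) * \<parallel>T x\<parallel>\<^bsub>F\<^esub> powr q = \<parallel>T (\<lambda>k\<in>{1..m}. y k (j k))\<parallel>\<^bsub>F\<^esub> powr q"
      using w by (simp add: powr_mult prod_nonneg prod_powr)
  qed simp
  also have "\<dots> \<le> (C * (\<Prod>k=1..m. weak_norm K p (E k) (y k))) powr q"
    using bound qp(1) y(1) by (rule summing_boundD)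
  also have "\<dots> \<le> (C * (\<Prod>k=1..m. W * b k)) powr q"
    using C qp y prod_weak_norm_nonneg[of y p]
    by (intro powr_mono2 mult_left_mono prod_mono) (auto intro: banach_space.weak_norm_nonneg[OF domain])
  finally show ?thesis .
qed

text \<open>The weight is 1 at index 0 and 0 elsewhere, so each test sequence has the single term
  \<open>x k\<close>, and \<open>W = 1\<close>.\<close>

lemma summing_bound_pointwise:
  assumes T: "T \<in> bounded_multilinear K m E F" and bound: "summing_bound K m E F q p T C"
    and qp: "0 < q" "0 < p" and x: "x \<in> tuples m E"
    and b: "\<And>k \<phi>. k \<in> {1..m} \<Longrightarrow> \<phi> \<in> dual_ball K (E k) \<Longrightarrow> cmod (\<phi> (x k)) \<le> b k"
  shows "\<parallel>T x\<parallel>\<^bsub>F\<^esub> \<le> C * prod b {1..m}"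
proof -
  have le: "(\<Sum>l<Suc 0. (if l = 0 then 1 else 0) powr q) ^ m * \<parallel>T x\<parallel>\<^bsub>F\<^esub> powr q \<le> (C * (\<Prod>k=1..m. 1 * b k)) powr q"
  proof (rule summing_bound_constant_directions[OF T bound qp x])
    fix n :: nat
    have "(\<Sum>j<n. (if j = 0 then 1 else 0) powr p) = (\<Sum>j<n. if j = 0 then 1 else (0::real))"
      by (intro sum.cong) auto
    then show "(\<Sum>j<n. (if j = 0 then 1 else 0) powr p) \<le> (1::real) powr p"
      by simp
  qed (use b in auto)
  have "0 \<le> b k" if k: "k \<in> {1..m}" for k
    using b[OF k banach_space.zero_functional_in_dual_ball[OF domain[OF k]]] by simp
  then have "0 \<le> prod b {1..m}" by (rule prod_nonneg)
  moreover have "0 < C" using bound by (simp add: summing_bound_def)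
  ultimately show ?thesis
    using le qp(1) powr_less_mono2[of q "C * prod b {1..m}" "\<parallel>T x\<parallel>\<^bsub>F\<^esub>"]
    by (cases "\<parallel>T x\<parallel>\<^bsub>F\<^esub> \<le> C * prod b {1..m}") auto
qed

text \<open>If \<open>r < s\<close>, there is a weight in l_s outside l_r. Used along fixed vectors
  with \<open>T x\<close> nonzero, it would bound the partial sums of a divergent series.\<close>

lemma summing_exponent_ge:
  assumes "1 \<le> m" and T: "T \<in> bounded_multilinear K m E F" and bound: "summing_bound K m E F r s T C"
    and rs: "0 < r" "0 < s" and x: "x \<in> tuples m E" "T x \<noteq> \<zero>\<^bsub>F\<^esub>"
  shows "s \<le> r"
proof (rule ccontr)
  assume "\<not> s \<le> r"
  then have sr: "r < s" by simp
  \<comment> \<open>The r-th powers form the harmonic series, while the s-th powers are summable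
    because \<open>s / r > 1\<close>.\<close>
  define w :: "nat \<Rightarrow> real" where "w j = of_nat (Suc j) powr (- (1 / r))" for j
  have "summable (\<lambda>j. of_nat j powr (- (s / r)) :: real)"
    using sr rs by (subst summable_real_powr_iff) (simp add: field_simps)
  then have summable: "summable (\<lambda>j. w j powr s)"
    by (subst (asm) summable_Suc_iff[symmetric]) (simp add: w_def powr_powr)
  define W where "W = (\<Sum>j. w j powr s) powr (1 / s)"
  have W: "(\<Sum>j<n. w j powr s) \<le> W powr s" for n
    using rs summable by (simp add: W_def powr_powr suminf_nonneg sum_le_suminf)
  have norm_pos: "0 < \<parallel>T x\<parallel>\<^bsub>F\<^esub>"
    using F.vnorm_nonneg F.vnorm_eq_0 bounded_multilinear_closed[OF T x(1)] x(2) by (simp add: less_le)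
  define R where "R = (C * (\<Prod>k=1..m. W * \<parallel>x k\<parallel>\<^bsub>E k\<^esub>)) powr r"
  have harmonic: "(\<Sum>l<n. 1 / real (Suc l)) ^ m * \<parallel>T x\<parallel>\<^bsub>F\<^esub> powr r \<le> R" for n
  proof -
    have "w l powr r = 1 / real (Suc l)" for l
    proof -
      have "w l powr r = real (Suc l) powr (- (1 / r) * r)"
        unfolding w_def by (rule powr_powr)
      then show ?thesis using rs by (simp add: powr_minus_divide)
    qed
    moreover have "(\<Sum>l<n. w l powr r) ^ m * \<parallel>T x\<parallel>\<^bsub>F\<^esub> powr r \<le> R"
      unfolding R_def
    proof (rule summing_bound_constant_directions[OF T bound rs x(1) _ _ W])
      show "cmod (\<phi> (x k)) \<le> \<parallel>x k\<parallel>\<^bsub>E k\<^esub>" if "k \<in> {1..m}" "\<phi> \<in> dual_ball K (E k)" for k \<phi>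
        using that(2) tuples_carrier[OF x(1) that(1)] by (rule dual_ballD(4))
    qed (simp_all add: w_def W_def)
    ultimately show ?thesis by simp
  qed
  \<comment> \<open>Only the m-th power is bounded so far. A partial sum above 1 is at most its m-th
    power; the summand 1 covers the others.\<close>
  have "(\<Sum>l<n. 1 / real (Suc l)) \<le> 1 + R / \<parallel>T x\<parallel>\<^bsub>F\<^esub> powr r" for n
  proof (cases "(\<Sum>l<n. 1 / real (Suc l)) \<le> 1")
    case False
    then have "(\<Sum>l<n. 1 / real (Suc l)) \<le> (\<Sum>l<n. 1 / real (Suc l)) ^ m"
      using \<open>1 \<le> m\<close> by (intro self_le_power) auto
    also have "\<dots> \<le> R / \<parallel>T x\<parallel>\<^bsub>F\<^esub> powr r"
      using harmonic norm_pos by (simp add: field_simps)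
    finally show ?thesis by simp
  next
    case True
    moreover have "0 \<le> R" by (simp add: R_def)
    ultimately show ?thesis by (meson add_increasing2 divide_nonneg_nonneg powr_ge_zero)
  qed
  then have "summable (\<lambda>l. 1 / real (Suc l))"
    by (intro summableI_nonneg_bounded) auto
  then show False
    using not_summable_harmonic[where 'a = real] summable_Suc_iff[of "\<lambda>l. 1 / real l"]
    by (simp add: inverse_eq_divide)
qed

section \<open>Elementary tensors as extremal operators\<close>

definition elementary_tensor :: "(nat \<Rightarrow> 'a \<Rightarrow> complex) \<Rightarrow> 'b \<Rightarrow> (nat \<Rightarrow> 'a) \<Rightarrow> 'b"
  where "elementary_tensor \<psi> y = (\<lambda>x\<in>tuples m E. (\<Prod>k=1..m. \<psi> k (x k)) \<odot>\<^bsub>F\<^esub> y)"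

context
  fixes \<psi> :: "nat \<Rightarrow> 'a \<Rightarrow> complex" and y :: 'b
  assumes K: "K = \<real> \<or> K = UNIV"
    and \<psi>: "\<And>k. k \<in> {1..m} \<Longrightarrow> \<psi> k \<in> dual_ball K (E k)"
    and y: "y \<in> carrier F"
begin

lemma prod_functionals_closed:
  assumes "x \<in> tuples m E" "J \<subseteq> {1..m}"
  shows "(\<Prod>k\<in>J. \<psi> k (x k)) \<in> K"
proof -
  have "\<psi> k (x k) \<in> K" if "k \<in> J" for k
    using that assms by (intro dual_ballD(1)[OF \<psi>] tuples_carrier) auto
  then show ?thesis
    using K by (auto intro: prod_in_Reals)
qed

lemma norm_elementary_tensor:
  assumes "x \<in> tuples m E"
  shows "\<parallel>elementary_tensor \<psi> y x\<parallel>\<^bsub>F\<^esub> = (\<Prod>k=1..m. cmod (\<psi> k (x k))) * \<parallel>y\<parallel>\<^bsub>F\<^esub>"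
  using assms y prod_functionals_closed[OF assms]
  by (simp add: elementary_tensor_def F.vnorm_smult prod_norm)

lemma elementary_tensor_bounded_multilinear:
  "elementary_tensor \<psi> y \<in> bounded_multilinear K m E F"
proof -
  have closed: "(\<Prod>k=1..m. \<psi> k (x k)) \<odot>\<^bsub>F\<^esub> y \<in> carrier F" if "x \<in> tuples m E" for x
    using F.smult_closed[of _ y] prod_functionals_closed[OF that] y by simp
  \<comment> \<open>Isolates the only factor that depends on coordinate \<open>k\<close>.\<close>
  have update: "(\<Prod>i=1..m. \<psi> i ((x(k := a)) i)) = \<psi> k a * (\<Prod>i\<in>{1..m} - {k}. \<psi> i (x i))"
    if "k \<in> {1..m}" for x k a
    using that by (subst prod.remove[of _ k]) auto
  have rest: "(\<Prod>i\<in>{1..m} - {k}. \<psi> i (x i)) \<in> K" if "x \<in> tuples m E" for x k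
    using that by (intro prod_functionals_closed) auto
  have tensor: "elementary_tensor \<psi> y (x(k := a)) = (\<psi> k a * (\<Prod>i\<in>{1..m} - {k}. \<psi> i (x i))) \<odot>\<^bsub>F\<^esub> y"
    if "x \<in> tuples m E" "k \<in> {1..m}" "a \<in> carrier (E k)" for x k a
    using tuples_update[OF that] update[OF that(2)] by (simp add: elementary_tensor_def)
  have value_closed: "\<psi> k a \<in> K" if "k \<in> {1..m}" "a \<in> carrier (E k)" for k a
    using dual_ballD(1)[OF \<psi>] that by blast
  have "elementary_tensor \<psi> y (x(k := a \<oplus>\<^bsub>E k\<^esub> b))
      = elementary_tensor \<psi> y (x(k := a)) \<oplus>\<^bsub>F\<^esub> elementary_tensor \<psi> y (x(k := b))"
    if "x \<in> tuples m E" "k \<in> {1..m}" "a \<in> carrier (E k)" "b \<in> carrier (E k)" for x k a b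
  proof -
    interpret banach_space K "E k" using that(2) by (rule domain)
    show ?thesis
      using that value_closed rest[of x k] y F.scalar_mult_closed
        F.smult_l_distr[of "\<psi> k a * (\<Prod>i\<in>{1..m} - {k}. \<psi> i (x i))" "\<psi> k b * (\<Prod>i\<in>{1..m} - {k}. \<psi> i (x i))" y]
      by (simp add: tensor dual_ballD(2)[OF \<psi>] distrib_right)
  qed
  moreover have "elementary_tensor \<psi> y (x(k := c \<odot>\<^bsub>E k\<^esub> a)) = c \<odot>\<^bsub>F\<^esub> elementary_tensor \<psi> y (x(k := a))"
    if "x \<in> tuples m E" "k \<in> {1..m}" "c \<in> K" "a \<in> carrier (E k)" for x k c a
  proof -
    interpret banach_space K "E k" using that(2) by (rule domain)
    have "c \<odot>\<^bsub>E k\<^esub> a \<in> carrier (E k)" using that smult_closed[of c a] by simp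
    then show ?thesis
      using that value_closed rest[of x k] y F.scalar_mult_closed
        F.smult_assoc1[of c "\<psi> k a * (\<Prod>i\<in>{1..m} - {k}. \<psi> i (x i))" y]
      by (simp add: tensor dual_ballD(3)[OF \<psi>] mult.assoc)
  qed
  moreover have "\<parallel>elementary_tensor \<psi> y x\<parallel>\<^bsub>F\<^esub> \<le> \<parallel>y\<parallel>\<^bsub>F\<^esub> * (\<Prod>k=1..m. \<parallel>x k\<parallel>\<^bsub>E k\<^esub>)"
    if x: "x \<in> tuples m E" for x
  proof -
    have "(\<Prod>k=1..m. cmod (\<psi> k (x k))) \<le> (\<Prod>k=1..m. \<parallel>x k\<parallel>\<^bsub>E k\<^esub>)"
      using dual_ballD(4)[OF \<psi>] tuples_carrier[OF x] by (intro prod_mono) auto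
    then show ?thesis
      using y F.vnorm_nonneg by (simp add: norm_elementary_tensor[OF x] mult.commute mult_left_mono)
  qed
  moreover have "elementary_tensor \<psi> y \<in> tuples m E \<rightarrow>\<^sub>E carrier F"
    using closed by (auto simp: elementary_tensor_def)
  ultimately show ?thesis
    unfolding bounded_multilinear_def by blast
qed

text \<open>The sum over the cube factors into one sum per coordinate. Each is controlled by the
  weak s-norm, since \<open>\<psi> k\<close> lies in the dual ball and l_s is contained in l_r with
  norm 1.\<close>

lemma elementary_tensor_summing_bound:
  assumes "0 < s" "s \<le> r" and norm_y: "\<parallel>y\<parallel>\<^bsub>F\<^esub> = 1"
  shows "summing_bound K m E F r s (elementary_tensor \<psi> y) 1"
proof (rule summing_boundI)
  fix x :: "nat \<Rightarrow> nat \<Rightarrow> 'a" and n :: nat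
  assume x: "\<And>k. k \<in> {1..m} \<Longrightarrow> x k \<in> weak_lp K s (E k)"
  have "(\<Sum>j\<in>{1..m} \<rightarrow>\<^sub>E {..<n}. \<parallel>elementary_tensor \<psi> y (\<lambda>k\<in>{1..m}. x k (j k))\<parallel>\<^bsub>F\<^esub> powr r)
      = (\<Sum>j\<in>{1..m} \<rightarrow>\<^sub>E {..<n}. \<Prod>k=1..m. cmod (\<psi> k (x k (j k))) powr r)"
  proof (rule sum.cong)
    fix j
    have "(\<lambda>k\<in>{1..m}. x k (j k)) \<in> tuples m E"
      using x by (intro restrict_in_tuples weak_lp_carrier)
    then show "\<parallel>elementary_tensor \<psi> y (\<lambda>k\<in>{1..m}. x k (j k))\<parallel>\<^bsub>F\<^esub> powr r
        = (\<Prod>k=1..m. cmod (\<psi> k (x k (j k))) powr r)"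
      by (simp add: norm_elementary_tensor norm_y prod_powr)
  qed simp
  also have "\<dots> = (\<Prod>k=1..m. \<Sum>l<n. cmod (\<psi> k (x k l)) powr r)"
    by (simp add: prod_sum_PiE)
  also have "\<dots> \<le> (\<Prod>k=1..m. weak_norm K s (E k) (x k) powr r)"
  proof (rule prod_mono, intro conjI)
    fix k assume k: "k \<in> {1..m}"
    have "(\<Sum>l<n. cmod (\<psi> k (x k l)) powr r) = (\<Sum>l<n. (cmod (\<psi> k (x k l)) powr s) powr (r / s))"
      using assms by (simp add: powr_powr)
    also have "\<dots> \<le> (\<Sum>l<n. cmod (\<psi> k (x k l)) powr s) powr (r / s)"
      using assms by (intro sum_powr_le_powr_sum) auto
    also have "\<dots> \<le> (weak_norm K s (E k) (x k) powr s) powr (r / s)"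
      using assms x[OF k] \<psi>[OF k] by (intro powr_mono2 sum_le_weak_norm) (auto intro: sum_nonneg)
    finally show "(\<Sum>l<n. cmod (\<psi> k (x k l)) powr r) \<le> weak_norm K s (E k) (x k) powr r"
      using assms by (simp add: powr_powr)
  qed (auto intro: sum_nonneg)
  also have "\<dots> = (1 * (\<Prod>k=1..m. weak_norm K s (E k) (x k))) powr r"
    unfolding mult_1 by (intro prod_powr[symmetric] banach_space.weak_norm_nonneg[OF domain x])
  finally show "(\<Sum>j\<in>{1..m} \<rightarrow>\<^sub>E {..<n}. \<parallel>elementary_tensor \<psi> y (\<lambda>k\<in>{1..m}. x k (j k))\<parallel>\<^bsub>F\<^esub> powr r)
      \<le> (1 * (\<Prod>k=1..m. weak_norm K s (E k) (x k))) powr r" .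
qed (use assms in auto)

text \<open>A constant below 1 would contradict the pointwise bound at vectors where the functionals
  nearly attain their norm 1.\<close>

lemma elementary_tensor_summing_bound_ge:
  assumes "0 < q" "0 < p" and norm_y: "\<parallel>y\<parallel>\<^bsub>F\<^esub> = 1" and "1 \<le> m"
    and norming: "\<And>k d. k \<in> {1..m} \<Longrightarrow> d < 1 \<Longrightarrow>
      \<exists>x\<in>carrier (E k). 0 < \<parallel>x\<parallel>\<^bsub>E k\<^esub> \<and> d * \<parallel>x\<parallel>\<^bsub>E k\<^esub> < cmod (\<psi> k x)"
    and bound: "summing_bound K m E F q p (elementary_tensor \<psi> y) C"
  shows "1 \<le> C"
proof (rule ccontr)
  assume "\<not> 1 \<le> C"
  have "0 < C" using bound by (simp add: summing_bound_def)
  \<comment> \<open>The loss is shared equally among the \<open>m\<close> coordinates: a factor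
    \<open>d\<close> in each multiplies up to \<open>C\<close>.\<close>
  define d where "d = root m C"
  have d: "0 \<le> d" "d < 1" "d ^ m = C"
    using \<open>0 < C\<close> \<open>\<not> 1 \<le> C\<close> \<open>1 \<le> m\<close> by (auto simp: d_def)
  obtain z where z: "z k \<in> carrier (E k)" "0 < \<parallel>z k\<parallel>\<^bsub>E k\<^esub>" "d * \<parallel>z k\<parallel>\<^bsub>E k\<^esub> < cmod (\<psi> k (z k))"
    if "k \<in> {1..m}" for k
    using norming[OF _ d(2)] by metis
  define x where "x = (\<lambda>k\<in>{1..m}. z k)"
  have x: "x \<in> tuples m E" unfolding x_def using z(1) by (rule restrict_in_tuples)
  have "\<parallel>elementary_tensor \<psi> y x\<parallel>\<^bsub>F\<^esub> \<le> C * (\<Prod>k=1..m. \<parallel>x k\<parallel>\<^bsub>E k\<^esub>)"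
    using x tuples_carrier[OF x]
    by (intro summing_bound_pointwise[OF elementary_tensor_bounded_multilinear bound assms(1,2)])
      (auto intro: dual_ballD(4))
  also have "\<dots> = (\<Prod>k=1..m. d * \<parallel>z k\<parallel>\<^bsub>E k\<^esub>)"
    by (simp add: x_def prod.distrib d)
  also have "\<dots> < (\<Prod>k=1..m. cmod (\<psi> k (z k)))"
  proof (rule prod_mono_strict[where i = 1])
    fix k assume k: "k \<in> {1..m}"
    show "0 \<le> d * \<parallel>z k\<parallel>\<^bsub>E k\<^esub> \<and> d * \<parallel>z k\<parallel>\<^bsub>E k\<^esub> \<le> cmod (\<psi> k (z k))"
      using z(2,3)[OF k] d by simp
    show "0 < cmod (\<psi> k (z k))"
      using z(2,3)[OF k] d by (meson le_less_trans less_imp_le mult_nonneg_nonneg)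
  qed (use z(3) \<open>1 \<le> m\<close> in auto)
  also have "\<dots> = \<parallel>elementary_tensor \<psi> y x\<parallel>\<^bsub>F\<^esub>"
    unfolding norm_elementary_tensor[OF x] by (simp add: norm_y x_def)
  finally show False by simp
qed

end

end


section \<open>From constants in the summing inequality to the norm of the inclusion\<close>

section \<open>The norm of the inclusion\<close>

lemma summing_norm_le: "summing_bound K m E F q p T C \<Longrightarrow> summing_norm K m E F q p T \<le> C"
  unfolding summing_norm_def
  by (intro cInf_lower bdd_belowI[where m = 0]) (auto simp: summing_bound_def)

lemma inclusion_normI:
  assumes "\<And>T. T \<in> A \<Longrightarrow> n' T \<le> n T"
  shows "inclusion_norm A n n' \<le> 1"
  unfolding inclusion_norm_def using assms by (intro SUP_least) fastforce

text \<open>Ensures that the denominator of the target exponent is positive. If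
  \<open>m * r > s\<close>, the bound on \<open>u\<close> only has to be cleared of its
  denominator.\<close>

lemma inclusion_exponent_pos:
  assumes "1 \<le> r" "1 \<le> s" "1 \<le> u"
    and "ereal u < ereal (real m * r * s) / ereal (real m * r - s)"
  shows "0 < s * u + real m * r * s - real m * r * u"
proof (cases "real m * r = s")
  case True
  \<comment> \<open>By the convention 1/0 = infinity the bound on \<open>u\<close> is void here; the
    expression reduces to \<open>s * s\<close>.\<close>
  then show ?thesis using assms by (simp add: algebra_simps)
next
  case False
  then have u: "u < real m * r * s / (real m * r - s)" using assms by simp
  have "0 < real m * r - s"
  proof (rule ccontr)
    assume "\<not> 0 < real m * r - s"
    then have "real m * r * s / (real m * r - s) \<le> 0"
      using assms by (intro divide_nonneg_nonpos) auto
    then show False using u assms by simp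
  qed
  then show ?thesis using u by (simp add: field_simps)
qed

text \<open>In reciprocals, \<open>1 / q = 1 / r - m * (1 / s - 1 / u)\<close>, so \<open>q\<close>
  is at least \<open>r\<close> and hence at least 1. The class may consist of the zero operator
  alone, for instance if \<open>F\<close> is trivial; the inclusion then has norm 0, which is why
  the value 1 is tied to a nonzero operator.\<close>

theorem proposition3p4:
  fixes K :: "complex set" and m :: nat and r s u :: real
    and E :: "nat \<Rightarrow> 'a normed_space" and F :: "'b normed_space"
  assumes "K = \<real> \<or> K = UNIV"
    and "1 \<le> m" and "1 \<le> r" and "1 \<le> s" and "s \<le> u"
    and "ereal u < ereal (real m * r * s) / ereal (real m * r - s)"
    and "\<And>k. k \<in> {1..m} \<Longrightarrow> banach_space K (E k)" and "banach_space K F"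
  shows "let q = r * s * u / (s * u + real m * r * s - real m * r * u);
             A = multiple_summing K m E F r s;
             N = inclusion_norm A (summing_norm K m E F r s) (summing_norm K m E F q u)
         in A \<subseteq> multiple_summing K m E F q u \<and> N \<le> 1 \<and>
            ((\<exists>T\<in>A. \<exists>x\<in>tuples m E. T x \<noteq> \<zero>\<^bsub>F\<^esub>) \<longrightarrow> N = 1)"
proof -
  define q where "q = r * s * u / (s * u + real m * r * s - real m * r * u)"
  define A where "A = multiple_summing K m E F r s"
  define N where "N = inclusion_norm A (summing_norm K m E F r s) (summing_norm K m E F q u)"
  interpret banach_family K m E F
    by (intro banach_family.intro assms(7,8)) (use assms(1) in auto)
  have pos: "0 < s * u + real m * r * s - real m * r * u"
    using assms by (intro inclusion_exponent_pos) auto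
  have rsu: "0 < r" "0 < s" "0 < u" using assms by auto
  have q: "0 < q" "1 / q = 1 / r - real m * (1 / s - 1 / u)"
  proof -
    show "0 < q" using pos rsu by (simp add: q_def)
    have "1 / q = (s * u + real m * r * s - real m * r * u) / (r * s * u)"
      by (simp add: q_def)
    also have "\<dots> = 1 / r - real m * (1 / s - 1 / u)"
      using rsu by (simp add: field_simps)
    finally show "1 / q = 1 / r - real m * (1 / s - 1 / u)" .
  qed
  \<comment> \<open>Every constant carries over unchanged, which yields both the inclusion and
    \<open>N \<le> 1\<close>. The case \<open>s = u\<close> is separate because \<open>t\<close>
    would be infinite.\<close>
  have bound: "summing_bound K m E F q u T C"
    if "T \<in> bounded_multilinear K m E F" "summing_bound K m E F r s T C" for T C
  proof (cases "s = u")
    case True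
    then have "q = r" using q rsu by simp
    then show ?thesis using that True by simp
  next
    case False
    then have "s < u" using \<open>s \<le> u\<close> by simp
    then show ?thesis by (rule summing_bound_inclusion[OF that rsu(2) _ rsu(1) q])
  qed
  have subset: "A \<subseteq> multiple_summing K m E F q u"
    using bound by (auto simp: A_def multiple_summing_def)
  have N_le: "N \<le> 1"
    unfolding N_def
  proof (rule inclusion_normI)
    fix T assume "T \<in> A"
    then obtain C where T: "T \<in> bounded_multilinear K m E F" "summing_bound K m E F r s T C"
      by (auto simp: A_def multiple_summing_def)
    show "summing_norm K m E F q u T \<le> summing_norm K m E F r s T"
      unfolding summing_norm_def[of K m E F r s T]
      using T bound[OF T(1), THEN summing_norm_le] by (intro cInf_greatest) auto
  qed
  have "N = 1" if "T \<in> A" "x \<in> tuples m E" "T x \<noteq> \<zero>\<^bsub>F\<^esub>" for T x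
  proof -
    obtain C where T: "T \<in> bounded_multilinear K m E F" and C: "summing_bound K m E F r s T C"
      using \<open>T \<in> A\<close> by (auto simp: A_def multiple_summing_def)
    have "s \<le> r" by (rule summing_exponent_ge[OF \<open>1 \<le> m\<close> T C rsu(1,2) that(2,3)])
    have Tx: "T x \<in> carrier F" "0 < \<parallel>T x\<parallel>\<^bsub>F\<^esub>"
      using bounded_multilinear_closed[OF T] that F.vnorm_nonneg F.vnorm_eq_0
      by (auto simp: less_le)
    \<comment> \<open>If every functional vanished at \<open>x k\<close>, the pointwise bound could
      be used with the value 0 in coordinate \<open>k\<close> and would force \<open>T x\<close> to
      be 0.\<close>
    have nontrivial: "\<exists>\<phi>\<in>dual_ball K (E k). \<phi> (x k) \<noteq> 0" if k: "k \<in> {1..m}" for k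
    proof (rule ccontr)
      assume zero: "\<not> ?thesis"
      have "\<parallel>T x\<parallel>\<^bsub>F\<^esub> \<le> C * (\<Prod>i=1..m. if i = k then 0 else \<parallel>x i\<parallel>\<^bsub>E i\<^esub>)"
      proof (rule summing_bound_pointwise[OF T C rsu(1,2) \<open>x \<in> tuples m E\<close>])
        fix i \<phi> assume i: "i \<in> {1..m}" and \<phi>: "\<phi> \<in> dual_ball K (E i)"
        show "cmod (\<phi> (x i)) \<le> (if i = k then 0 else \<parallel>x i\<parallel>\<^bsub>E i\<^esub>)"
          using zero \<phi> dual_ballD(4)[OF \<phi> tuples_carrier[OF \<open>x \<in> tuples m E\<close> i]] by auto
      qed
      also have "(\<Prod>i=1..m. if i = k then 0 else \<parallel>x i\<parallel>\<^bsub>E i\<^esub>) = 0"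
        using k by (intro prod_zero) auto
      finally show False using Tx by simp
    qed
    have "\<exists>\<psi>\<in>dual_ball K (E k). \<forall>d<1. \<exists>z\<in>carrier (E k). 0 < \<parallel>z\<parallel>\<^bsub>E k\<^esub> \<and> d * \<parallel>z\<parallel>\<^bsub>E k\<^esub> < cmod (\<psi> z)"
      if k: "k \<in> {1..m}" for k
    proof -
      obtain \<phi> where \<phi>: "\<phi> \<in> dual_ball K (E k)" "\<phi> (x k) \<noteq> 0"
        using nontrivial[OF k] by blast
      obtain \<psi> where "\<psi> \<in> dual_ball K (E k)"
        "\<And>d. d < 1 \<Longrightarrow> \<exists>z\<in>carrier (E k). 0 < \<parallel>z\<parallel>\<^bsub>E k\<^esub> \<and> d * \<parallel>z\<parallel>\<^bsub>E k\<^esub> < cmod (\<psi> z)"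
        using banach_space.norming_functional[OF domain[OF k] real_scalars \<phi>(1)
            tuples_carrier[OF \<open>x \<in> tuples m E\<close> k] \<phi>(2)]
        by blast
      then show ?thesis by blast
    qed
    then have "\<forall>k\<in>{1..m}. \<exists>\<psi>. \<psi> \<in> dual_ball K (E k) \<and>
        (\<forall>d<1. \<exists>z\<in>carrier (E k). 0 < \<parallel>z\<parallel>\<^bsub>E k\<^esub> \<and> d * \<parallel>z\<parallel>\<^bsub>E k\<^esub> < cmod (\<psi> z))"
      by blast
    from bchoice[OF this] obtain \<psi> where \<psi>: "\<And>k. k \<in> {1..m} \<Longrightarrow> \<psi> k \<in> dual_ball K (E k)"
      and norming: "\<And>k d. k \<in> {1..m} \<Longrightarrow> d < 1 \<Longrightarrow>
        \<exists>z\<in>carrier (E k). 0 < \<parallel>z\<parallel>\<^bsub>E k\<^esub> \<and> d * \<parallel>z\<parallel>\<^bsub>E k\<^esub> < cmod (\<psi> k z)"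
      by blast
    \<comment> \<open>The nonzero value \<open>T x\<close> supplies the unit vector of
      \<open>F\<close>.\<close>
    define y where "y = of_real (1 / \<parallel>T x\<parallel>\<^bsub>F\<^esub>) \<odot>\<^bsub>F\<^esub> T x"
    have y: "y \<in> carrier F" "\<parallel>y\<parallel>\<^bsub>F\<^esub> = 1"
    proof -
      show "y \<in> carrier F"
        unfolding y_def by (rule F.smult_closed) (use scalar_of_real Tx(1) in \<open>simp_all del: of_real_divide\<close>)
      show "\<parallel>y\<parallel>\<^bsub>F\<^esub> = 1"
        unfolding y_def F.vnorm_smult[OF scalar_of_real Tx(1)] using Tx(2) by (simp add: norm_divide)
    qed
    define S where "S = elementary_tensor \<psi> y"
    have S: "S \<in> bounded_multilinear K m E F"
      unfolding S_def using assms(1) \<psi> y(1) by (rule elementary_tensor_bounded_multilinear)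
    have S1: "summing_bound K m E F r s S 1"
      unfolding S_def by (rule elementary_tensor_summing_bound[OF assms(1) \<psi> y(1) rsu(2) \<open>s \<le> r\<close> y(2)])
    \<comment> \<open>Thus \<open>S\<close> lies in the unit ball of the smaller class, while its
      norm in the larger one is at least 1.\<close>
    have "1 \<le> C" if "summing_bound K m E F q u S C" for C
      by (rule elementary_tensor_summing_bound_ge
          [OF assms(1) \<psi> y(1) q(1) rsu(3) y(2) assms(2) norming that[unfolded S_def]])
    then have "1 \<le> summing_norm K m E F q u S"
      unfolding summing_norm_def using bound[OF S S1] by (intro cInf_greatest) auto
    moreover have "S \<in> {T \<in> A. summing_norm K m E F r s T \<le> 1}"
      using S S1 summing_norm_le by (auto simp: A_def multiple_summing_def)
    ultimately have "1 \<le> N"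
      unfolding N_def inclusion_norm_def by (intro SUP_upper2[of S]) auto
    with N_le show ?thesis by simp
  qed
  with subset N_le show ?thesis
    unfolding Let_def A_def N_def q_def by blast
qed

end
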